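(* Let $A,B\subset\mathbb{R}^3$ be two convex solids that are not of constant width. Then there exist convex solids $F_A$ and $F_B$ such that $F_A$ is a friend of $A$, $F_B$ is a friend of $B$, and $F_A$ and $F_B$ are friends of each other.
   Context: A convex solid is a compact convex subset of $\mathbb{R}^3$ with nonempty interior. The width of a solid in a given direction (unit vector $u$) is the distance between its two opposite parallel supporting planes perpendicular to $u$, i.e. $w_A(u)=\max_{x\in A}\langle x,u\rangle-\min_{x\in A}\langle x,u\rangle$. A convex solid has constant width if its width is the same in every direction. A convex solid $A$ can Rupert through a convex solid $B$ if a congruent copy of $A$ can pass, by a rigid translation along some direction, through a straight hole cut through $B$ along that direction, without splitting $B$ (the hole does not reach the lateral boundary of $B$). Precisely: there are unit vectors $u,v\in\mathbb{R}^3$ such that, writing $\pi_u(A)$ for the orthogonal projection of $A$ onto the plane $u^\perp$ and $\pi_v(B)$ for the orthogonal projection of $B$ onto the plane $v^\perp$, some isometric copy of $\pi_u(A)$ in the plane $v^\perp$ (the image of $\pi_u(A)$ under an isometry $u^\perp\to v^\perp$) is contained in the interior of $\pi_v(B)$ relative to $v^\perp$. Two convex solids $A$ and $B$ (possibly $A=B$) are friends if $A$ can Rupert through $B$ and $B$ can Rupert through $A$. *)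

theory Defs
  imports "HOL-Analysis.Analysis"
begin

definition convex_solid :: "(real^3) set \<Rightarrow> bool" where
  "convex_solid A \<longleftrightarrow> compact A \<and> convex A \<and> interior A \<noteq> {}"

(* On compact nonempty A both SUP and INF are attained, see width_attained. *)
definition width :: "(real^3) set \<Rightarrow> real^3 \<Rightarrow> real" where
  "width A u = (SUP x\<in>A. x \<bullet> u) - (INF x\<in>A. x \<bullet> u)"

definition constant_width :: "(real^3) set \<Rightarrow> bool" where
  "constant_width A \<longleftrightarrow> (\<forall>u v. norm u = 1 \<longrightarrow> norm v = 1 \<longrightarrow> width A u = width A v)"

(* The orthogonal projection onto the plane perpendicular to u; only meant for unit vectors u. *)
definition proj :: "real^3 \<Rightarrow> real^3 \<Rightarrow> real^3" where
  "proj u x = x - (x \<bullet> u) *\<^sub>R u"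

definition isometry_between :: "(real^3) set \<Rightarrow> (real^3) set \<Rightarrow> (real^3 \<Rightarrow> real^3) \<Rightarrow> bool" where
  "isometry_between P Q f \<longleftrightarrow> f ` P = Q \<and> (\<forall>x\<in>P. \<forall>y\<in>P. dist (f x) (f y) = dist x y)"

(* The isometry f may reverse orientation. *)
definition can_Rupert_through :: "(real^3) set \<Rightarrow> (real^3) set \<Rightarrow> bool" where
  "can_Rupert_through A B \<longleftrightarrow>
     (\<exists>u v f. norm u = 1 \<and> norm v = 1 \<and> isometry_between ({u}\<^sup>\<bottom>) ({v}\<^sup>\<bottom>) f \<and>
        f ` (proj u ` A) \<subseteq> top_of_set ({v}\<^sup>\<bottom>) interior_of (proj v ` B))"

definition friends :: "(real^3) set \<Rightarrow> (real^3) set \<Rightarrow> bool" where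
  "friends A B \<longleftrightarrow> can_Rupert_through A B \<and> can_Rupert_through B A"

lemma width_attained:
  assumes "compact A" "A \<noteq> {}"
  shows "\<exists>x\<in>A. \<exists>y\<in>A. (\<forall>z\<in>A. y \<bullet> u \<le> z \<bullet> u \<and> z \<bullet> u \<le> x \<bullet> u) \<and> width A u = x \<bullet> u - y \<bullet> u"
proof -
  have c: "continuous_on A (\<lambda>x. x \<bullet> u)"
    by (intro continuous_intros)
  obtain x where x: "x \<in> A" "\<forall>z\<in>A. z \<bullet> u \<le> x \<bullet> u"
    using continuous_attains_sup[OF assms c] by blast
  obtain y where y: "y \<in> A" "\<forall>z\<in>A. y \<bullet> u \<le> z \<bullet> u"
    using continuous_attains_inf[OF assms c] by blast
  have "(SUP z\<in>A. z \<bullet> u) = x \<bullet> u"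
    by (rule cSup_eq_maximum) (use x in auto)
  moreover have "(INF z\<in>A. z \<bullet> u) = y \<bullet> u"
    by (rule cInf_eq_minimum) (use y in auto)
  ultimately show ?thesis
    using x y by (auto simp: width_def)
qed

lemma proj_eq_closest_point:
  assumes "norm u = 1"
  shows "proj u x = closest_point ({u}\<^sup>\<bottom>) x"
proof -
  have uu: "u \<bullet> u = 1"
    using assms by (simp add: norm_eq_1)
  have sub: "subspace ({u}\<^sup>\<bottom>)"
    by (rule subspace_orthogonal_comp)
  have mem: "proj u x \<in> {u}\<^sup>\<bottom>"
    using uu by (simp add: proj_def orthogonal_comp_def orthogonal_def inner_diff_right inner_commute)
  have "dist x (proj u x) \<le> dist x z" if "z \<in> {u}\<^sup>\<bottom>" for z
  proof -
    have "u \<bullet> z = 0"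
      using that by (simp add: orthogonal_comp_def orthogonal_def)
    then have "x \<bullet> u = u \<bullet> (x - z)"
      by (simp add: inner_diff_right inner_commute)
    then have "\<bar>x \<bullet> u\<bar> \<le> norm (x - z)"
      using Cauchy_Schwarz_ineq2[of u "x - z"] assms by simp
    then show ?thesis
      using assms by (simp add: proj_def dist_norm)
  qed
  then show ?thesis
    using closest_point_unique[OF subspace_imp_convex[OF sub] closed_subspace[OF sub] mem] by blast
qed

end

theory Submission
  imports Defs
begin

text \<open>A convex body that is not of constant width has a direction in which its width is smaller than
  its diameter, because the diameter bounds every width. Fix \<open>2 * h\<close> strictly in between and consider
  the rectangular brick of half-sides \<open>\<delta>\<close>, \<open>h\<close>, \<open>L\<close>, with \<open>\<delta>\<close> tiny and \<open>L\<close> huge. Seen along its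
  shortest side, the brick shows a very long strip of breadth \<open>2 * h\<close>, and the body slips through this
  strip when its narrow direction is turned across it (\<open>body_Ruperts_through_brick\<close>). Seen along its
  longest side, the brick shows hardly more than a segment of length \<open>2 * h\<close>; the interior of the body
  contains a longer segment, so the brick slips through the body when pushed perpendicularly to that
  segment (\<open>brick_Ruperts_through_body\<close>). Hence the brick is a friend of the body.

  Two such bricks with the same \<open>\<delta>\<close> and \<open>L\<close> are friends of each other whatever their middle sides
  are: the \<open>\<delta>\<close>-by-\<open>h\<close> face of one passes through the \<open>h'\<close>-by-\<open>L\<close> face of the other
  (\<open>brick_Ruperts_through_brick\<close>). Since the bounds required of \<open>\<delta>\<close> and \<open>L\<close> only ask that they be
  small and large enough, common values serve two given bodies.\<close>

section \<open>Passing through a hole by a rigid motion\<close>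

lemma orthogonal_comp_singleton_iff: "x \<in> {v}\<^sup>\<bottom> \<longleftrightarrow> x \<bullet> v = 0"
  by (auto simp: orthogonal_comp_def orthogonal_def inner_commute)

lemma proj_in_orthogonal_comp:
  assumes "norm v = 1"
  shows "proj v x \<in> {v}\<^sup>\<bottom>"
  using assms by (simp add: orthogonal_comp_singleton_iff proj_def inner_diff_left norm_eq_1)

text \<open>Orthogonal projection onto a plane is an open map: a point of the plane is covered by the
  image of an open set iff its fibre meets that set, so the image is the trace on the plane of a union
  of translates.\<close>

lemma openin_proj_image:
  assumes "norm v = 1" "open S"
  shows "openin (top_of_set ({v}\<^sup>\<bottom>)) (proj v ` S)"
proof -
  have fibre: "proj v (y + t *\<^sub>R v) = y" if "y \<bullet> v = 0" for y t
    using that assms(1) by (simp add: proj_def inner_add_left norm_eq_1)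
  have "proj v ` S = {v}\<^sup>\<bottom> \<inter> (\<Union>t. (\<lambda>x. -(t *\<^sub>R v) + x) ` S)"
  proof (intro equalityI subsetI)
    fix y assume "y \<in> proj v ` S"
    then obtain x where x: "x \<in> S" "y = proj v x" by blast
    have "y = -((x \<bullet> v) *\<^sub>R v) + x"
      using x by (simp add: proj_def)
    then have "y \<in> (\<Union>t. (\<lambda>x. -(t *\<^sub>R v) + x) ` S)"
      using x(1) by (intro UN_I[of "x \<bullet> v"]) auto
    then show "y \<in> {v}\<^sup>\<bottom> \<inter> (\<Union>t. (\<lambda>x. -(t *\<^sub>R v) + x) ` S)"
      using proj_in_orthogonal_comp[OF assms(1)] x(2) by simp
  next
    fix y assume "y \<in> {v}\<^sup>\<bottom> \<inter> (\<Union>t. (\<lambda>x. -(t *\<^sub>R v) + x) ` S)"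
    then obtain t x where x: "y \<bullet> v = 0" "x \<in> S" "y = -(t *\<^sub>R v) + x"
      by (auto simp: orthogonal_comp_singleton_iff)
    have "x = y + t *\<^sub>R v"
      using x(3) by simp
    then have "proj v x = y"
      using fibre[OF x(1)] by simp
    then show "y \<in> proj v ` S"
      using x(2) by blast
  qed
  moreover have "open (\<Union>t. (\<lambda>x. -(t *\<^sub>R v) + x) ` S)"
    using assms(2) by (intro open_UN ballI open_translation)
  ultimately show ?thesis
    by (auto simp: openin_open)
qed

text \<open>Place \<open>A\<close> by the rigid motion \<open>x \<mapsto> T x + c\<close> and slide it along \<open>v\<close>: it passes through \<open>B\<close> if
  every line in direction \<open>v\<close> through a point of the placed copy meets the interior of \<open>B\<close>. This
  replaces isometries between planes by motions of the whole space; the direction of projection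
  for \<open>A\<close> is the preimage of \<open>v\<close> under \<open>T\<close>.\<close>

lemma can_Rupert_through_by_motion:
  assumes T: "orthogonal_transformation T" and v: "norm v = 1"
    and hit: "\<And>x. x \<in> A \<Longrightarrow> \<exists>t. T x + c + t *\<^sub>R v \<in> interior B"
  shows "can_Rupert_through A B"
proof -
  have lin: "linear T" and inner_T: "\<And>x y. T x \<bullet> T y = x \<bullet> y"
    using T by (auto simp: orthogonal_transformation_def)
  obtain u where u: "T u = v"
    using orthogonal_transformation_surj[OF T] by (metis surjD)
  then have nu: "norm u = 1"
    using v orthogonal_transformation_norm[OF T] by metis
  define f where "f x = T x + proj v c" for x
  have cv: "proj v c \<bullet> v = 0"
    using proj_in_orthogonal_comp[OF v] by (simp add: orthogonal_comp_singleton_iff)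
  have "f ` ({u}\<^sup>\<bottom>) = {v}\<^sup>\<bottom>"
  proof (intro equalityI subsetI)
    fix y assume "y \<in> f ` ({u}\<^sup>\<bottom>)"
    then obtain x where "x \<bullet> u = 0" "y = f x"
      by (auto simp: orthogonal_comp_singleton_iff)
    moreover have "T x \<bullet> v = x \<bullet> u"
      using inner_T u by metis
    ultimately show "y \<in> {v}\<^sup>\<bottom>"
      using cv by (simp add: orthogonal_comp_singleton_iff f_def inner_add_left)
  next
    fix y assume y: "y \<in> {v}\<^sup>\<bottom>"
    obtain x where x: "T x = y - proj v c"
      using orthogonal_transformation_surj[OF T] by (metis surjD)
    have "x \<bullet> u = T x \<bullet> v"
      using inner_T u by metis
    then have "x \<bullet> u = 0"
      using x y cv by (simp add: orthogonal_comp_singleton_iff inner_diff_left)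
    moreover have "f x = y"
      using x by (simp add: f_def)
    ultimately show "y \<in> f ` ({u}\<^sup>\<bottom>)"
      by (force simp: orthogonal_comp_singleton_iff)
  qed
  moreover have "dist (f x) (f y) = dist x y" for x y
    using T by (simp add: f_def orthogonal_transformation_isometry)
  ultimately have iso: "isometry_between ({u}\<^sup>\<bottom>) ({v}\<^sup>\<bottom>) f"
    by (simp add: isometry_between_def)
  have "f (proj u x) \<in> proj v ` interior B" if "x \<in> A" for x
  proof -
    obtain t where t: "T x + c + t *\<^sub>R v \<in> interior B"
      using hit[OF \<open>x \<in> A\<close>] by blast
    have "x \<bullet> u = T x \<bullet> v"
      using inner_T u by metis
    then have "f (proj u x) = proj v (T x + c + t *\<^sub>R v)"
      using v by (simp add: f_def proj_def linear_diff[OF lin] linear_cmul[OF lin] u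
          inner_add_left norm_eq_1 algebra_simps)
    then show ?thesis
      using t by blast
  qed
  moreover have "proj v ` interior B \<subseteq> top_of_set ({v}\<^sup>\<bottom>) interior_of (proj v ` B)"
    by (intro interior_of_maximal image_mono interior_subset openin_proj_image v open_interior)
  ultimately have "f ` (proj u ` A) \<subseteq> top_of_set ({v}\<^sup>\<bottom>) interior_of (proj v ` B)"
    by blast
  then show ?thesis
    unfolding can_Rupert_through_def using nu v iso by blast
qed

section \<open>Bricks\<close>

definition brick :: "real \<Rightarrow> real \<Rightarrow> real \<Rightarrow> (real^3) set" where
  "brick a b c = cbox (- vector [a, b, c]) (vector [a, b, c])"

lemma mem_brick_iff: "x \<in> brick a b c \<longleftrightarrow> \<bar>x$1\<bar> \<le> a \<and> \<bar>x$2\<bar> \<le> b \<and> \<bar>x$3\<bar> \<le> c"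
  by (auto simp: brick_def mem_box_cart forall_3 vector_3)

lemma mem_interior_brick_iff:
  "x \<in> interior (brick a b c) \<longleftrightarrow> \<bar>x$1\<bar> < a \<and> \<bar>x$2\<bar> < b \<and> \<bar>x$3\<bar> < c"
  by (auto simp: brick_def interior_cbox mem_box_cart forall_3 vector_3)

lemma convex_solid_brick:
  assumes "a > 0" "b > 0" "c > 0"
  shows "convex_solid (brick a b c)"
proof -
  have "0 \<in> interior (brick a b c)"
    using assms by (simp add: mem_interior_brick_iff)
  then show ?thesis
    by (auto simp: convex_solid_def brick_def)
qed

text \<open>The cyclic permutation of the coordinates turns the long side of the first brick into the
  direction of the short side of the second, along which the motion takes place.\<close>

lemma brick_Ruperts_through_brick:
  assumes "\<delta> > 0" "\<delta> < b'" "b < L"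
  shows "can_Rupert_through (brick \<delta> b L) (brick \<delta> b' L)"
proof (rule can_Rupert_through_by_motion)
  define T :: "real^3 \<Rightarrow> real^3" where "T x = vector [x$3, x$1, x$2]" for x
  show "orthogonal_transformation T"
    unfolding orthogonal_transformation_def
  proof (intro conjI allI)
    show "linear T"
      by (rule linearI) (auto simp: T_def vec_eq_iff forall_3 vector_3)
    show "T x \<bullet> T y = x \<bullet> y" for x y
      by (simp add: T_def inner_vec_def sum_3 vector_3)
  qed
  show "norm (axis 1 1 :: real^3) = 1"
    by simp
  show "\<exists>t. T x + 0 + t *\<^sub>R axis 1 1 \<in> interior (brick \<delta> b' L)" if "x \<in> brick \<delta> b L" for x
  proof
    show "T x + 0 + (- x$3) *\<^sub>R axis 1 1 \<in> interior (brick \<delta> b' L)"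
      using that assms by (auto simp: mem_brick_iff mem_interior_brick_iff T_def vector_3 axis_def)
  qed
qed

section \<open>A brick befriending a given body\<close>

text \<open>The narrow direction \<open>d\<close> of the body is turned to the second coordinate axis, and a translation
  along this axis centres the body in the strip; along the third axis the size of the brick alone suffices, and along the first one
  the body is moved.\<close>

lemma body_Ruperts_through_brick:
  assumes "compact A" "A \<noteq> {}" "norm d = 1" "width A d < 2 * h"
    and "\<delta> > 0" and L: "\<And>x. x \<in> A \<Longrightarrow> norm x < L"
  shows "can_Rupert_through A (brick \<delta> h L)"
proof -
  obtain p q where pq: "\<forall>z\<in>A. q \<bullet> d \<le> z \<bullet> d \<and> z \<bullet> d \<le> p \<bullet> d" "width A d = p \<bullet> d - q \<bullet> d"
    using width_attained[OF assms(1,2)] by blast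
  obtain T :: "real^3 \<Rightarrow> real^3" where T: "orthogonal_transformation T" "T d = axis 2 1"
    using orthogonal_transformation_exists_1[of d "axis 2 1"] assms(3) by auto
  have second: "T x $ 2 = x \<bullet> d" for x
  proof -
    have "T x \<bullet> T d = x \<bullet> d"
      using T(1) by (auto simp: orthogonal_transformation_def)
    then show ?thesis
      by (simp add: T(2) inner_axis)
  qed
  define m where "m = (p \<bullet> d + q \<bullet> d) / 2"
  show ?thesis
  proof (rule can_Rupert_through_by_motion[OF T(1)])
    show "norm (axis 1 1 :: real^3) = 1"
      by simp
    show "\<exists>t. T x + axis 2 (- m) + t *\<^sub>R axis 1 1 \<in> interior (brick \<delta> h L)" if "x \<in> A" for x
    proof
      have "\<bar>T x $ 3\<bar> \<le> norm (T x)"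
        by (rule component_le_norm_cart)
      also have "\<dots> < L"
        using L[OF that] orthogonal_transformation_norm[OF T(1)] by simp
      finally have "\<bar>T x $ 3\<bar> < L" .
      moreover have "\<bar>x \<bullet> d - m\<bar> < h"
        using pq that assms(4) by (force simp: m_def abs_less_iff field_simps)
      ultimately show "T x + axis 2 (- m) + (- T x $ 1) *\<^sub>R axis 1 1 \<in> interior (brick \<delta> h L)"
        using \<open>\<delta> > 0\<close> by (simp add: mem_interior_brick_iff axis_def second)
    qed
  qed
qed

text \<open>The middle side of the brick is laid along the segment from \<open>x\<close> to \<open>y\<close>, the two midpoints
  coinciding, and the brick moves along its long side. Only its short side leaves the segment then,
  by at most \<open>\<delta> < r\<close>.\<close>

lemma brick_Ruperts_through_body:
  assumes long: "2 * h < dist x y" and "h > 0" and "\<delta> < r"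
    and nbhd: "\<And>z w. z \<in> closed_segment x y \<Longrightarrow> dist z w < r \<Longrightarrow> w \<in> interior A"
  shows "can_Rupert_through (brick \<delta> h L) A"
proof -
  define d where "d = (1 / dist x y) *\<^sub>R (y - x)"
  have pos: "dist x y > 0"
    using assms by linarith
  have nd: "norm d = 1"
    using pos by (simp add: d_def dist_norm norm_minus_commute)
  obtain T :: "real^3 \<Rightarrow> real^3" where T: "orthogonal_transformation T" "T (axis 2 1) = d"
    using orthogonal_transformation_exists_1[of "axis 2 1" d] nd by auto
  have lin: "linear T"
    using T(1) by (auto simp: orthogonal_transformation_def)
  show ?thesis
  proof (rule can_Rupert_through_by_motion[OF T(1)])
    show "norm (T (axis 3 1)) = 1"
      using orthogonal_transformation_norm[OF T(1)] by simp
    show "\<exists>t. T b + midpoint x y + t *\<^sub>R T (axis 3 1) \<in> interior A" if b: "b \<in> brick \<delta> h L" for b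
    proof
      define z where "z = midpoint x y + (b$2) *\<^sub>R d"
      have "b = (b$1) *\<^sub>R axis 1 1 + (b$2) *\<^sub>R axis 2 1 + (b$3) *\<^sub>R axis 3 1"
        by (simp add: vec_eq_iff forall_3 axis_def)
      then have "T b = (b$1) *\<^sub>R T (axis 1 1) + (b$2) *\<^sub>R d + (b$3) *\<^sub>R T (axis 3 1)"
        using linear_add[OF lin] linear_cmul[OF lin] T(2) by metis
      then have eq: "T b + midpoint x y + (- b$3) *\<^sub>R T (axis 3 1) = z + (b$1) *\<^sub>R T (axis 1 1)"
        by (simp add: z_def)
      define s where "s = 1/2 + b$2 / dist x y"
      have "\<bar>b$2\<bar> \<le> dist x y / 2"
        using b long by (simp add: mem_brick_iff)
      then have "0 \<le> s" "s \<le> 1"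
        using pos by (auto simp: s_def field_simps)
      moreover have "z = (1 - s) *\<^sub>R x + s *\<^sub>R y"
      proof -
        have "z = midpoint x y + (s - 1/2) *\<^sub>R (y - x)"
          by (simp add: z_def d_def s_def)
        also have "\<dots> = (1 - s) *\<^sub>R x + s *\<^sub>R y"
          by (simp add: vec_eq_iff midpoint_def algebra_simps)
        finally show ?thesis .
      qed
      ultimately have "z \<in> closed_segment x y"
        by (auto simp: in_segment)
      moreover have "dist z (z + (b$1) *\<^sub>R T (axis 1 1)) < r"
        using b \<open>\<delta> < r\<close> orthogonal_transformation_norm[OF T(1)]
        by (simp add: dist_norm mem_brick_iff)
      ultimately show "T b + midpoint x y + (- b$3) *\<^sub>R T (axis 3 1) \<in> interior A"
        unfolding eq by (rule nbhd)
    qed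
  qed
qed

text \<open>The two points of \<open>A\<close> on the supporting planes perpendicular to \<open>e\<close> are at least the width
  apart. They lie on the boundary, but interior points approximate them, and the strict inequality
  leaves room for that.\<close>

lemma exists_long_segment_in_interior:
  assumes "convex_solid A" "norm e = 1" "l < width A e"
  obtains x y where "x \<in> interior A" "y \<in> interior A" "l < dist x y"
proof -
  have A: "compact A" "convex A" "interior A \<noteq> {}" "A \<noteq> {}"
    using assms(1) interior_subset by (auto simp: convex_solid_def)
  obtain p q where pq: "p \<in> A" "q \<in> A" "width A e = p \<bullet> e - q \<bullet> e"
    using width_attained[OF A(1,4)] by blast
  have "(p - q) \<bullet> e \<le> norm (p - q)"
    using norm_cauchy_schwarz[of "p - q" e] assms(2) by simp
  then have pql: "l < dist p q"
    using pq(3) assms(3) by (simp add: dist_norm inner_diff_left)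
  define \<eta> where "\<eta> = (dist p q - l) / 2"
  have "\<eta> > 0"
    using pql by (simp add: \<eta>_def)
  have "A \<subseteq> closure (interior A)"
    using convex_closure_interior[OF A(2,3)] closure_subset by blast
  then obtain x y where xy: "x \<in> interior A" "dist x p < \<eta>" "y \<in> interior A" "dist y q < \<eta>"
    using pq(1,2) \<open>\<eta> > 0\<close> by (meson closure_approachable subsetD)
  have "dist p q \<le> dist x p + dist x y + dist y q"
    by (smt (verit) dist_triangle dist_commute)
  then have "l < dist x y"
    using xy by (simp add: \<eta>_def)
  then show ?thesis
    using that xy by blast
qed

text \<open>The thresholds \<open>r\<close> and \<open>R\<close> leave room to choose the short and the long side of the brick
  simultaneously for several bodies.\<close>

lemma exists_befriending_bricks:
  assumes "convex_solid A" "\<not> constant_width A"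
  obtains h r R where "h > 0" "r > 0"
    "\<And>\<delta> L. 0 < \<delta> \<Longrightarrow> \<delta> < r \<Longrightarrow> R < L \<Longrightarrow> friends (brick \<delta> h L) A"
proof -
  have A: "compact A" "convex A" "A \<noteq> {}"
    using assms(1) interior_subset by (auto simp: convex_solid_def)
  obtain d e where de: "norm d = 1" "norm e = 1" "width A d < width A e"
    using assms(2) unfolding constant_width_def by (metis linorder_neqE_linordered_idom)
  define h where "h = (width A d + width A e) / 4"
  have h: "width A d < 2 * h" "2 * h < width A e"
    using de(3) by (auto simp: h_def)
  have "width A d \<ge> 0"
    using width_attained[OF A(1,3), of d] by force
  then have "h > 0"
    using h by linarith
  obtain x y where xy: "x \<in> interior A" "y \<in> interior A" "2 * h < dist x y"
    using exists_long_segment_in_interior[OF assms(1) de(2) h(2)] by blast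
  have "closed_segment x y \<subseteq> interior A"
    using xy A(2) by (simp add: closed_segment_subset convex_interior)
  then obtain r where r: "r > 0" "(\<Union>z\<in>closed_segment x y. ball z r) \<subseteq> interior A"
    using compact_subset_open_imp_ball_epsilon_subset[of "closed_segment x y" "interior A"] by auto
  obtain R where R: "\<And>z. z \<in> A \<Longrightarrow> norm z \<le> R"
    using compact_imp_bounded[OF A(1)] by (auto simp: bounded_iff)
  show ?thesis
  proof (rule that[of h r R])
    fix \<delta> L assume \<delta>: "0 < \<delta>" "\<delta> < r" and L: "R < L"
    have "can_Rupert_through (brick \<delta> h L) A"
      using r(2) by (intro brick_Ruperts_through_body[OF xy(3) \<open>h > 0\<close> \<delta>(2)])
        (auto simp: subset_iff)
    moreover have "can_Rupert_through A (brick \<delta> h L)"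
      using R L by (intro body_Ruperts_through_brick[OF A(1,3) de(1) h(1) \<delta>(1)]) force
    ultimately show "friends (brick \<delta> h L) A"
      by (simp add: friends_def)
  qed (use \<open>h > 0\<close> r in auto)
qed

theorem theorem3:
  fixes A B :: "(real^3) set"
  assumes "convex_solid A" and "convex_solid B"
    and "\<not> constant_width A" and "\<not> constant_width B"
  shows "\<exists>F\<^sub>A F\<^sub>B. convex_solid F\<^sub>A \<and> convex_solid F\<^sub>B \<and>
           friends F\<^sub>A A \<and> friends F\<^sub>B B \<and> friends F\<^sub>A F\<^sub>B"
proof -
  obtain a r R where a: "a > 0" "r > 0"
    "\<And>\<delta> L. 0 < \<delta> \<Longrightarrow> \<delta> < r \<Longrightarrow> R < L \<Longrightarrow> friends (brick \<delta> a L) A"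
    using exists_befriending_bricks[OF assms(1,3)] by blast
  obtain b r' R' where b: "b > 0" "r' > 0"
    "\<And>\<delta> L. 0 < \<delta> \<Longrightarrow> \<delta> < r' \<Longrightarrow> R' < L \<Longrightarrow> friends (brick \<delta> b L) B"
    using exists_befriending_bricks[OF assms(2,4)] by blast
  obtain \<delta> where \<delta>: "0 < \<delta>" "\<delta> < Min {r, r', a, b}"
    using dense[of 0 "Min {r, r', a, b}"] a b by auto
  obtain L where L: "Max {R, R', a, b} < L"
    using gt_ex by blast
  have "friends (brick \<delta> a L) (brick \<delta> b L)"
    using \<delta> L by (simp add: friends_def brick_Ruperts_through_brick)
  moreover have "friends (brick \<delta> a L) A" "friends (brick \<delta> b L) B"
    using \<delta> L by (simp_all add: a(3) b(3))
  moreover have "convex_solid (brick \<delta> a L)" "convex_solid (brick \<delta> b L)"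
    using \<delta> L a(1) b(1) by (auto intro!: convex_solid_brick)
  ultimately show ?thesis
    by blast
qed

end
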